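(* Let $\Omega$ be a nonempty open convex subset of $\mathbb{R}^n$ equipped with its tautological weak Finsler structure $\widetilde{\Omega}$. Then, for every $x$ and $y$ in $\Omega$, the Euclidean segment connecting $x$ to $y$ is of minimal length (that is, the length $\ell$ of the affine segment from $x$ to $y$ equals $d_\Omega(x,y)$), and the weak metric $d_\Omega$ on $\Omega$ associated to the tautological weak Finsler structure is the Funk weak metric: $$d_{\Omega}(x,y)=F(x,y).$$
   Context: Identify $T\Omega\simeq\Omega\times\mathbb{R}^n$. The tautological weak Finsler structure on $\Omega$ is $\widetilde{\Omega}=\{(x,\xi)\in T\Omega \mid x\in\Omega,\ x+\xi\in\Omega\}$. Its Lagrangian is $p(x,\xi)=\inf\{t>0\mid x+t^{-1}\xi\in\Omega\}\in[0,\infty)$. The length of a piecewise $C^1$ path $\gamma:[a,b]\to\Omega$ is $\ell(\gamma)=\int_a^b p(\gamma(t),\dot\gamma(t))\,dt$, and the associated weak metric is $d_\Omega(x,y)=\inf\ell(\gamma)$, the infimum being over all piecewise $C^1$ paths in $\Omega$ from $x$ to $y$. The Funk weak metric $F=F_\Omega$ is defined for $x,y\in\Omega$ as follows. For $x\neq y$, let $R(x,y)$ be the half-line with origin $x$ passing through $y$. If $x\ne y$ and $R(x,y)\not\subset\Omega$, let $a^+$ be the unique point of $R(x,y)\cap\partial\Omega$ and set $$F(x,y)=\log\frac{|x-a^+|}{|y-a^+|}.$$ Otherwise set $F(x,y)=0$. Here $|\cdot|$ is the Euclidean norm. *)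

theory Defs
  imports "HOL-Analysis.Analysis"
begin

text \<open>A subset of the tangent bundle of Euclidean space is a set of pairs (point, vector).\<close>

definition tautological :: "'a::euclidean_space set \<Rightarrow> ('a \<times> 'a) set" where
  "tautological \<Omega> = {(x, \<xi>). x \<in> \<Omega> \<and> x + \<xi> \<in> \<Omega>}"

definition lagrangian :: "('a::euclidean_space \<times> 'a) set \<Rightarrow> 'a \<Rightarrow> 'a \<Rightarrow> real" where
  "lagrangian W x \<xi> = Inf {t. t > 0 \<and> (x, inverse t *\<^sub>R \<xi>) \<in> W}"

lemma lagrangian_tautological:
  assumes "x \<in> \<Omega>"
  shows "lagrangian (tautological \<Omega>) x \<xi> = Inf {t. t > 0 \<and> x + inverse t *\<^sub>R \<xi> \<in> \<Omega>}"
  using assms by (simp add: lagrangian_def tautological_def)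

text \<open>
  The library predicate \<open>piecewise_C1_differentiable_on\<close> does not control the derivative near the
  exceptional points, so it admits curves of infinite length, whose (undefined) length integral
  would be \<open>0\<close>.  Here each closed piece is required to be continuously differentiable up to its end
  points, with one-sided derivatives there.
\<close>

definition C1_piece :: "(real \<Rightarrow> 'a::euclidean_space) \<Rightarrow> real \<Rightarrow> real \<Rightarrow> bool" where
  "C1_piece \<gamma> u v \<longleftrightarrow>
     (\<exists>D. (\<forall>t\<in>{u..v}. (\<gamma> has_vector_derivative D t) (at t within {u..v})) \<and>
          continuous_on {u..v} D)"

definition piecewise_C1_path :: "(real \<Rightarrow> 'a::euclidean_space) \<Rightarrow> real \<Rightarrow> real \<Rightarrow> bool" where
  "piecewise_C1_path \<gamma> a b \<longleftrightarrow>
     continuous_on {a..b} \<gamma> \<and>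
     (\<exists>(k::nat) \<tau>. \<tau> 0 = a \<and> \<tau> k = b \<and>
        (\<forall>i<k. \<tau> i < \<tau> (Suc i) \<and> C1_piece \<gamma> (\<tau> i) (\<tau> (Suc i))))"

text \<open>The finitely many parameters at which the derivative may not exist do not affect the integral.\<close>

definition finsler_length ::
  "('a::euclidean_space \<times> 'a) set \<Rightarrow> real \<Rightarrow> real \<Rightarrow> (real \<Rightarrow> 'a) \<Rightarrow> real" where
  "finsler_length W a b \<gamma> =
     integral {a..b} (\<lambda>t. lagrangian W (\<gamma> t) (vector_derivative \<gamma> (at t within {a..b})))"

definition path_lengths ::
  "'a::euclidean_space set \<Rightarrow> ('a \<times> 'a) set \<Rightarrow> 'a \<Rightarrow> 'a \<Rightarrow> real set" where
  "path_lengths M W x y =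
     {finsler_length W a b \<gamma> | a b \<gamma>.
        a < b \<and> piecewise_C1_path \<gamma> a b \<and> \<gamma> ` {a..b} \<subseteq> M \<and> \<gamma> a = x \<and> \<gamma> b = y}"

definition weak_metric ::
  "'a::euclidean_space set \<Rightarrow> ('a \<times> 'a) set \<Rightarrow> 'a \<Rightarrow> 'a \<Rightarrow> real" where
  "weak_metric M W x y = Inf (path_lengths M W x y)"

definition half_line :: "'a::euclidean_space \<Rightarrow> 'a \<Rightarrow> 'a set" where
  "half_line x y = {x + s *\<^sub>R (y - x) | s. s \<ge> 0}"

definition funk :: "'a::euclidean_space set \<Rightarrow> 'a \<Rightarrow> 'a \<Rightarrow> real" where
  "funk \<Omega> x y =
     (if x \<noteq> y \<and> \<not> half_line x y \<subseteq> \<Omega>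
      then let a = (THE a. a \<in> half_line x y \<inter> frontier \<Omega>)
           in ln (norm (x - a) / norm (y - a))
      else 0)"

text \<open>
  The infima in \<open>lagrangian\<close> and \<open>weak_metric\<close> are taken over nonempty sets that are bounded below,
  so the totalised \<open>Inf\<close> on the reals is the genuine infimum.
\<close>

lemma lagrangian_set_nonempty:
  fixes \<Omega> :: "'a::euclidean_space set"
  assumes "open \<Omega>" "x \<in> \<Omega>"
  shows "{t. t > 0 \<and> (x, inverse t *\<^sub>R \<xi>) \<in> tautological \<Omega>} \<noteq> {}"
proof -
  obtain e where e: "e > 0" "ball x e \<subseteq> \<Omega>"
    using assms by (meson open_contains_ball)
  define t where "t = (norm \<xi> + 1) / e"
  have t: "t > 0" using e by (simp add: t_def add_nonneg_pos)
  have "norm (inverse t *\<^sub>R \<xi>) = e * (norm \<xi> / (norm \<xi> + 1))"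
    using t e by (simp add: t_def field_simps)
  also have "\<dots> < e * 1"
    using e by (intro mult_strict_left_mono) (auto simp: divide_less_eq add_nonneg_pos)
  finally have "x + inverse t *\<^sub>R \<xi> \<in> ball x e"
    by (simp add: dist_norm)
  then show ?thesis using t e assms by (auto simp: tautological_def)
qed

lemma lagrangian_nonneg:
  fixes \<Omega> :: "'a::euclidean_space set"
  assumes "open \<Omega>" "x \<in> \<Omega>"
  shows "lagrangian (tautological \<Omega>) x \<xi> \<ge> 0"
  unfolding lagrangian_def
  by (rule cInf_greatest[OF lagrangian_set_nonempty[OF assms]]) auto

lemma path_lengths_nonneg:
  fixes \<Omega> :: "'a::euclidean_space set"
  assumes "open \<Omega>" "l \<in> path_lengths \<Omega> (tautological \<Omega>) x y"
  shows "l \<ge> 0"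
proof -
  obtain a b \<gamma> where l: "l = finsler_length (tautological \<Omega>) a b \<gamma>" and "\<gamma> ` {a..b} \<subseteq> \<Omega>"
    using assms(2) by (auto simp: path_lengths_def)
  then have "\<forall>t\<in>{a..b}. lagrangian (tautological \<Omega>) (\<gamma> t)
      (vector_derivative \<gamma> (at t within {a..b})) \<ge> 0"
    using lagrangian_nonneg[OF assms(1)] by blast
  then show ?thesis unfolding l finsler_length_def
    by (metis (no_types, lifting) integral_nonneg not_integrable_integral order_refl)
qed

lemma linepath_length_in_path_lengths:
  fixes \<Omega> :: "'a::euclidean_space set"
  assumes "convex \<Omega>" "x \<in> \<Omega>" "y \<in> \<Omega>"
  shows "finsler_length W 0 1 (linepath x y) \<in> path_lengths \<Omega> W x y"
proof -
  have "C1_piece (linepath x y) 0 1"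
    unfolding C1_piece_def
    by (rule exI[of _ "\<lambda>_. y - x"]) (auto intro: has_vector_derivative_linepath_within)
  then have "piecewise_C1_path (linepath x y) 0 1"
    unfolding piecewise_C1_path_def
    by (intro conjI exI[of _ "1::nat"] exI[of _ real]) auto
  moreover have "linepath x y ` {0..1} \<subseteq> \<Omega>"
    using assms by (metis closed_segment_subset linepath_image_01)
  ultimately show ?thesis
    unfolding path_lengths_def
    by (intro CollectI exI[of _ "0::real"] exI[of _ "1::real"] exI[of _ "linepath x y"])
       (auto simp: linepath_0' linepath_1')
qed

end

theory Submission
  imports Defs
begin

text \<open>
  The Lagrangian of the tautological structure at a point of the domain is the reciprocal of the
  time at which the ray issuing from that point in the given direction leaves the domain.  On the
  affine segment \<open>t \<mapsto> x + t *\<^sub>R (y - x)\<close>, whose ray leaves the domain at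
  \<open>a = x + s *\<^sub>R (y - x)\<close>, it therefore equals \<open>1 / (s - t)\<close>, and integration gives
  \<open>ln (s / (s - 1)) = ln (norm (x - a) / norm (y - a))\<close>, which is the Funk weak metric
  (lemmas \<open>lagrangian_eq_inverse_exit_time\<close> and \<open>linepath_length_eq_ln\<close>).

  No path can be shorter.  At the exit point \<open>a\<close> there is a supporting hyperplane \<open>n \<bullet> z = c\<close>, and
  the domain lies in the open half-space \<open>n \<bullet> z < c\<close>.  Enlarging the domain cannot
  increase the Lagrangian, so it is at least that of the half-space and hence at least
  \<open>n \<bullet> \<xi> / (c - n \<bullet> z)\<close> (lemma \<open>lagrangian_ge_halfspace\<close>).  Along a path the
  latter is the exact derivative of \<open>- ln (c - n \<bullet> \<gamma> t)\<close>; it contributes the same amount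
  \<open>ln ((c - n \<bullet> x) / (c - n \<bullet> y))\<close> whatever the path, and by similar triangles this amount is again
  \<open>ln (s / (s - 1))\<close> (lemma \<open>path_length_ge_halfspace\<close>).

  This comparison of integrals presupposes that the Lagrangian is integrable along a piecewise
  \<open>C\<^sup>1\<close> path, because a non-integrable function has integral \<open>0\<close> by convention.  Integrability
  follows from the joint continuity of the Lagrangian in point and vector (lemma
  \<open>continuous_on_lagrangian_tautological\<close>).

  If the ray never leaves the domain, the Lagrangian vanishes along the segment, and both sides
  are \<open>0\<close>.
\<close>

section \<open>Rays in an open convex set\<close>

text \<open>
  Every point strictly between an interior point and a point of the closure is interior, hence a
  ray that has reached the frontier cannot have met it before and cannot come back.
\<close>

lemma ray_mem_iff_before_exit:
  fixes \<Omega> :: "'a::euclidean_space set"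
  assumes "open \<Omega>" "convex \<Omega>" "x \<in> \<Omega>" "x + s *\<^sub>R v \<in> frontier \<Omega>" "s \<ge> 0" "r \<ge> 0"
  shows "x + r *\<^sub>R v \<in> \<Omega> \<longleftrightarrow> r < s"
proof -
  have seg: "x + p *\<^sub>R v \<in> \<Omega>" if "0 \<le> p" "p < q" "x + q *\<^sub>R v \<in> closure \<Omega>" for p q
  proof (cases "p = 0 \<or> v = 0")
    case True
    then show ?thesis using assms by auto
  next
    case False
    have "x + p *\<^sub>R v = (1 - p / q) *\<^sub>R x + (p / q) *\<^sub>R (x + q *\<^sub>R v)"
      using that by (simp add: algebra_simps)
    then have "x + p *\<^sub>R v \<in> open_segment x (x + q *\<^sub>R v)"
      unfolding in_segment using that False by (auto intro!: exI[of _ "p / q"])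
    then show ?thesis
      using in_interior_closure_convex_segment[OF assms(2) _ that(3), of x] assms
      by (auto simp: interior_open)
  qed
  have a: "x + s *\<^sub>R v \<in> closure \<Omega>" "x + s *\<^sub>R v \<notin> \<Omega>"
    using assms by (auto simp: frontier_def interior_open)
  show ?thesis
  proof
    assume r: "x + r *\<^sub>R v \<in> \<Omega>"
    then have "x + r *\<^sub>R v \<in> closure \<Omega>" using closure_subset by blast
    then show "r < s" using seg[of s r] a r assms(5) by (cases r s rule: linorder_cases) auto
  qed (use seg a assms in blast)
qed

lemma ray_exits_at_frontier:
  fixes \<Omega> :: "'a::euclidean_space set"
  assumes "x \<in> \<Omega>" "\<not> half_line x y \<subseteq> \<Omega>"
  obtains s where "s \<ge> 0" "x + s *\<^sub>R (y - x) \<in> frontier \<Omega>"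
proof -
  have "half_line x y = (\<lambda>s. x + s *\<^sub>R (y - x)) ` {0..}"
    by (auto simp: half_line_def)
  moreover have "connected ((\<lambda>s. x + s *\<^sub>R (y - x)) ` {0::real..})"
    by (intro connected_continuous_image continuous_intros) (simp add: is_interval_connected_1[symmetric])
  ultimately have "connected (half_line x y)" by simp
  moreover have "x \<in> half_line x y" by (auto simp: half_line_def intro!: exI[of _ 0])
  ultimately have "half_line x y \<inter> frontier \<Omega> \<noteq> {}"
    using connected_Int_frontier[of "half_line x y" \<Omega>] assms by auto
  then show thesis using that by (auto simp: half_line_def)
qed

lemma supporting_hyperplane_open_convex:
  fixes \<Omega> :: "'a::euclidean_space set"
  assumes "open \<Omega>" "convex \<Omega>" "a \<notin> \<Omega>"
  obtains n where "\<And>z. z \<in> \<Omega> \<Longrightarrow> n \<bullet> z < n \<bullet> a"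
proof (cases "\<Omega> = {}")
  case True
  then show thesis using that by blast
next
  case False
  then obtain n b where n: "n \<noteq> 0" "\<forall>z\<in>\<Omega>. n \<bullet> z \<le> b" "\<forall>z\<in>{a}. n \<bullet> z \<ge> b"
    using separating_hyperplane_sets[of \<Omega> "{a}"] assms by auto
  have "n \<bullet> z < n \<bullet> a" if "z \<in> \<Omega>" for z
  proof -
    obtain e where e: "e > 0" "cball z e \<subseteq> \<Omega>"
      using assms(1) \<open>z \<in> \<Omega>\<close> open_contains_cball by blast
    \<comment> \<open>Openness leaves room for a small step towards the hyperplane, so the inequality is strict.\<close>
    have "z + (e / norm n) *\<^sub>R n \<in> \<Omega>"
      using e n(1) by (intro subsetD[OF e(2)]) (simp add: dist_norm)
    then have "n \<bullet> z + (e / norm n) * (n \<bullet> n) \<le> n \<bullet> a"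
      using n by (force simp: inner_add_right)
    moreover have "(e / norm n) * (n \<bullet> n) > 0" using e n(1) by simp
    ultimately show ?thesis by linarith
  qed
  then show thesis using that by blast
qed

section \<open>The Lagrangian of the tautological structure\<close>

text \<open>
  The infimum gives a point of the domain further out on the ray; convexity yields the nearer point.
\<close>

lemma mem_of_lagrangian_less:
  fixes \<Omega> :: "'a::euclidean_space set"
  assumes "open \<Omega>" "convex \<Omega>" "x \<in> \<Omega>" "t > 0"
    and "lagrangian (tautological \<Omega>) x \<xi> < t"
  shows "x + inverse t *\<^sub>R \<xi> \<in> \<Omega>"
proof -
  obtain u where u: "u > 0" "u < t" "x + inverse u *\<^sub>R \<xi> \<in> \<Omega>"
    using cInf_lessD[OF lagrangian_set_nonempty[OF assms(1,3)]] assms(5)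
    unfolding lagrangian_def by (auto simp: tautological_def)
  have "x + inverse t *\<^sub>R \<xi> = (1 - u / t) *\<^sub>R x + (u / t) *\<^sub>R (x + inverse u *\<^sub>R \<xi>)"
    using u assms(4) by (simp add: algebra_simps divide_inverse)
  also have "\<dots> \<in> \<Omega>"
    using u assms by (intro convexD) auto
  finally show ?thesis .
qed

lemma lagrangian_le:
  fixes \<Omega> :: "'a::euclidean_space set"
  assumes "x \<in> \<Omega>" "t > 0" "x + inverse t *\<^sub>R \<xi> \<in> \<Omega>"
  shows "lagrangian (tautological \<Omega>) x \<xi> \<le> t"
  unfolding lagrangian_tautological[OF assms(1)]
  by (rule cInf_lower) (use assms in \<open>auto intro!: bdd_belowI[of _ 0]\<close>)

lemma lagrangian_ge_halfspace:
  fixes \<Omega> :: "'a::euclidean_space set"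
  assumes "open \<Omega>" "x \<in> \<Omega>" "\<And>z. z \<in> \<Omega> \<Longrightarrow> n \<bullet> z < c"
  shows "(n \<bullet> \<xi>) / (c - n \<bullet> x) \<le> lagrangian (tautological \<Omega>) x \<xi>"
  unfolding lagrangian_def
proof (rule cInf_greatest[OF lagrangian_set_nonempty[OF assms(1,2)]])
  fix t assume "t \<in> {t. t > 0 \<and> (x, inverse t *\<^sub>R \<xi>) \<in> tautological \<Omega>}"
  then have t: "t > 0" "n \<bullet> (x + inverse t *\<^sub>R \<xi>) < c"
    using assms(3) by (auto simp: tautological_def)
  then show "(n \<bullet> \<xi>) / (c - n \<bullet> x) \<le> t"
    using assms(3)[OF assms(2)] by (simp add: field_simps inner_add_right)
qed

text \<open>
  Upper semicontinuity holds because the domain is open: the condition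
  \<open>x + inverse t *\<^sub>R \<xi> \<in> \<Omega>\<close> that bounds the Lagrangian by \<open>t\<close> persists nearby.  Lower
  semicontinuity holds because this condition may be tested on the closure instead, as a ray meets
  the frontier of an open convex set at most once, and exclusion from the closure persists as well.
\<close>

lemma continuous_on_lagrangian_tautological:
  fixes \<Omega> :: "'a::euclidean_space set"
  assumes "open \<Omega>" "convex \<Omega>"
  shows "continuous_on (\<Omega> \<times> UNIV) (\<lambda>z. lagrangian (tautological \<Omega>) (fst z) (snd z))"
  unfolding continuous_on_def
proof
  fix z assume "z \<in> \<Omega> \<times> (UNIV :: 'a set)"
  then have z: "fst z \<in> \<Omega>" by auto
  let ?F = "at z within \<Omega> \<times> (UNIV :: 'a set)"
  let ?L = "\<lambda>w. lagrangian (tautological \<Omega>) (fst w) (snd w)"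
  have near: "((\<lambda>w. fst w + inverse t *\<^sub>R snd w) \<longlongrightarrow> fst z + inverse t *\<^sub>R snd z) ?F" for t :: real
    by (intro tendsto_intros)
  have dom: "eventually (\<lambda>w. fst w \<in> \<Omega>) ?F"
    unfolding eventually_at_filter by (intro always_eventually) auto
  show "(?L \<longlongrightarrow> ?L z) ?F"
  proof (rule order_tendstoI)
    fix r assume r: "r < ?L z"
    show "eventually (\<lambda>w. r < ?L w) ?F"
    proof (cases "r < 0")
      case True
      show ?thesis
        by (rule eventually_mono[OF dom])
          (rule less_le_trans[OF True lagrangian_nonneg[OF assms(1)]])
    next
      case False
      obtain t where t: "r < t" "t < ?L z" using dense r by blast
      obtain u where u: "t < u" "u < ?L z" using dense t by blast
      have "fst z + inverse t *\<^sub>R snd z \<notin> closure \<Omega>"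
      proof
        assume "fst z + inverse t *\<^sub>R snd z \<in> closure \<Omega>"
        moreover have "fst z + inverse u *\<^sub>R snd z \<notin> \<Omega>"
          using lagrangian_le[OF z, of u] u t False by force
        moreover have "fst z + inverse t *\<^sub>R snd z \<notin> \<Omega>"
          using lagrangian_le[OF z, of t] t False by force
        ultimately show False
          using ray_mem_iff_before_exit[OF assms z, of "inverse t" "snd z" "inverse u"] t u False
            assms(1) by (auto simp: frontier_def interior_open)
      qed
      then have "eventually (\<lambda>w. fst w + inverse t *\<^sub>R snd w \<in> - closure \<Omega>) ?F"
        by (intro topological_tendstoD[OF near]) auto
      with dom show ?thesis
      proof eventually_elim
        case (elim w)
        then have "fst w + inverse t *\<^sub>R snd w \<notin> \<Omega>" using closure_subset by blast
        then have "\<not> ?L w < t"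
          using mem_of_lagrangian_less[OF assms, of "fst w" t "snd w"] elim t False by auto
        then show ?case using t by linarith
      qed
    qed
  next
    fix r assume r: "?L z < r"
    obtain t where t: "?L z < t" "t < r" using dense r by blast
    have "t > 0" using lagrangian_nonneg[OF assms(1) z, of "snd z"] t by linarith
    then have "eventually (\<lambda>w. fst w + inverse t *\<^sub>R snd w \<in> \<Omega>) ?F"
      using mem_of_lagrangian_less[OF assms z] t
      by (intro topological_tendstoD[OF near] assms(1)) auto
    with dom show "eventually (\<lambda>w. ?L w < r) ?F"
      by eventually_elim (use lagrangian_le \<open>t > 0\<close> t in fastforce)
  qed
qed

lemma lagrangian_eq_inverse_exit_time:
  fixes \<Omega> :: "'a::euclidean_space set"
  assumes "open \<Omega>" "convex \<Omega>" "x \<in> \<Omega>" "s > 0" "x + s *\<^sub>R \<xi> \<in> frontier \<Omega>"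
  shows "lagrangian (tautological \<Omega>) x \<xi> = 1 / s"
proof -
  have "x + inverse t *\<^sub>R \<xi> \<in> \<Omega> \<longleftrightarrow> 1 / s < t" if "t > 0" for t
    using ray_mem_iff_before_exit[OF assms(1,2,3,5), of "inverse t"] assms(4) that
    by (simp add: field_simps)
  moreover have "t > 0" if "1 / s < t" for t
    using assms(4) that by (meson less_trans zero_less_divide_1_iff)
  ultimately have "{t. t > 0 \<and> x + inverse t *\<^sub>R \<xi> \<in> \<Omega>} = {1 / s<..}"
    by blast
  then show ?thesis by (simp add: lagrangian_tautological[OF assms(3)])
qed

lemma lagrangian_eq_0_of_ray_subset:
  fixes \<Omega> :: "'a::euclidean_space set"
  assumes "x \<in> \<Omega>" "\<And>r. r \<ge> 0 \<Longrightarrow> x + r *\<^sub>R \<xi> \<in> \<Omega>"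
  shows "lagrangian (tautological \<Omega>) x \<xi> = 0"
proof -
  have "{t. t > 0 \<and> x + inverse t *\<^sub>R \<xi> \<in> \<Omega>} = {0<..}"
    using assms(2) by auto
  then show ?thesis by (simp add: lagrangian_tautological[OF assms(1)])
qed

section \<open>Lower bound for the length of a path\<close>

text \<open>
  On one piece the Lagrangian along the path is continuous, and it dominates the derivative of
  \<open>- ln (c - n \<bullet> \<gamma> t)\<close>.  The derivative in the length integral is taken relative to the whole
  parameter interval; it agrees with that of the piece except perhaps at the two break points.
\<close>

lemma piece_length_ge_halfspace:
  fixes \<Omega> :: "'a::euclidean_space set"
  assumes "open \<Omega>" "convex \<Omega>" "\<And>z. z \<in> \<Omega> \<Longrightarrow> n \<bullet> z < c"
    and piece: "C1_piece \<gamma> u v" "u < v" and sub: "{u..v} \<subseteq> {a..b}" and img: "\<gamma> ` {a..b} \<subseteq> \<Omega>"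
  defines "L \<equiv> \<lambda>t. lagrangian (tautological \<Omega>) (\<gamma> t) (vector_derivative \<gamma> (at t within {a..b}))"
  shows "L integrable_on {u..v}"
    and "ln (c - n \<bullet> \<gamma> u) - ln (c - n \<bullet> \<gamma> v) \<le> integral {u..v} L"
proof -
  obtain D where D: "\<And>t. t \<in> {u..v} \<Longrightarrow> (\<gamma> has_vector_derivative D t) (at t within {u..v})"
    and contD: "continuous_on {u..v} D"
    using piece(1) unfolding C1_piece_def by blast
  have cont\<gamma>: "continuous_on {u..v} \<gamma>"
    using D continuous_on_eq_continuous_within has_vector_derivative_continuous by blast
  have \<gamma>in: "\<gamma> t \<in> \<Omega>" if "t \<in> {u..v}" for t
    using that sub img by blast
  let ?M = "\<lambda>t. lagrangian (tautological \<Omega>) (\<gamma> t) (D t)"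
  have "continuous_on {u..v} ((\<lambda>z. lagrangian (tautological \<Omega>) (fst z) (snd z)) \<circ> (\<lambda>t. (\<gamma> t, D t)))"
    using \<gamma>in by (intro continuous_on_compose continuous_on_Pair cont\<gamma> contD
        continuous_on_subset[OF continuous_on_lagrangian_tautological[OF assms(1,2)]]) auto
  then have intM: "?M integrable_on {u..v}"
    by (intro integrable_continuous_real) (simp add: o_def)
  have eq: "L t = ?M t" if "t \<in> {u..v} - {u, v}" for t
  proof -
    have t: "t \<in> {u<..<v}" using that by auto
    then have "(\<gamma> has_vector_derivative D t) (at t)"
      using D[of t] by (simp add: at_within_Icc_at)
    then have "vector_derivative \<gamma> (at t within {a..b}) = D t"
      using t sub by (intro vector_derivative_at_within_ivl) auto
    then show ?thesis by (simp add: L_def)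
  qed
  show "L integrable_on {u..v}"
    by (rule integrable_spike_finite[of "{u, v}", OF _ eq intM]) auto
  have "((\<lambda>t. (n \<bullet> D t) / (c - n \<bullet> \<gamma> t)) has_integral
      (- ln (c - n \<bullet> \<gamma> v)) - (- ln (c - n \<bullet> \<gamma> u))) {u..v}"
  proof (rule fundamental_theorem_of_calculus)
    fix t assume t: "t \<in> {u..v}"
    have "((\<lambda>t. n \<bullet> \<gamma> t) has_vector_derivative n \<bullet> D t) (at t within {u..v})"
      by (rule bounded_linear.has_vector_derivative[OF bounded_linear_inner_right D[OF t]])
    then have "((\<lambda>t. n \<bullet> \<gamma> t) has_field_derivative n \<bullet> D t) (at t within {u..v})"
      by (simp add: has_real_derivative_iff_has_vector_derivative)
    then have "((\<lambda>t. - ln (c - n \<bullet> \<gamma> t)) has_field_derivative (n \<bullet> D t) / (c - n \<bullet> \<gamma> t))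
        (at t within {u..v})"
      using assms(3)[OF \<gamma>in[OF t]] by (auto intro!: derivative_eq_intros)
    then show "((\<lambda>t. - ln (c - n \<bullet> \<gamma> t)) has_vector_derivative (n \<bullet> D t) / (c - n \<bullet> \<gamma> t))
        (at t within {u..v})"
      by (simp add: has_real_derivative_iff_has_vector_derivative)
  qed (use piece in simp)
  moreover have "(?M has_integral integral {u..v} L) {u..v}"
    using intM integral_spike[of "{u, v}" "{u..v}" ?M L] eq by (auto simp: integrable_integral)
  ultimately have "(- ln (c - n \<bullet> \<gamma> v)) - (- ln (c - n \<bullet> \<gamma> u)) \<le> integral {u..v} L"
    using lagrangian_ge_halfspace[OF assms(1) \<gamma>in assms(3)] by (rule has_integral_le) auto
  then show "ln (c - n \<bullet> \<gamma> u) - ln (c - n \<bullet> \<gamma> v) \<le> integral {u..v} L" by simp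
qed

lemma path_length_ge_halfspace:
  fixes \<Omega> :: "'a::euclidean_space set"
  assumes "open \<Omega>" "convex \<Omega>" "\<And>z. z \<in> \<Omega> \<Longrightarrow> n \<bullet> z < c"
    and path: "piecewise_C1_path \<gamma> a b" and img: "\<gamma> ` {a..b} \<subseteq> \<Omega>"
  shows "ln (c - n \<bullet> \<gamma> a) - ln (c - n \<bullet> \<gamma> b) \<le> finsler_length (tautological \<Omega>) a b \<gamma>"
proof -
  define L where
    "L = (\<lambda>t. lagrangian (tautological \<Omega>) (\<gamma> t) (vector_derivative \<gamma> (at t within {a..b})))"
  obtain k \<tau> where \<tau>: "\<tau> 0 = a" "\<tau> (k::nat) = b"
    and step: "\<And>i. i < k \<Longrightarrow> \<tau> i < \<tau> (Suc i)" "\<And>i. i < k \<Longrightarrow> C1_piece \<gamma> (\<tau> i) (\<tau> (Suc i))"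
    using path unfolding piecewise_C1_path_def by blast
  have below: "\<tau> j \<le> b" if "j \<le> k" for j
    using that by (induction rule: inc_induct) (use \<tau> step in force)+
  have "a \<le> \<tau> j \<and> L integrable_on {a..\<tau> j} \<and>
      ln (c - n \<bullet> \<gamma> a) - ln (c - n \<bullet> \<gamma> (\<tau> j)) \<le> integral {a..\<tau> j} L" if "j \<le> k" for j
    using that
  proof (induction j)
    case 0
    show ?case by (simp add: \<tau> integrable_on_refl[of _ a, simplified])
  next
    case (Suc j)
    then have IH: "a \<le> \<tau> j" "L integrable_on {a..\<tau> j}"
      "ln (c - n \<bullet> \<gamma> a) - ln (c - n \<bullet> \<gamma> (\<tau> j)) \<le> integral {a..\<tau> j} L"
      and j: "j < k" by auto
    have "{\<tau> j..\<tau> (Suc j)} \<subseteq> {a..b}" using IH below[OF Suc.prems] by auto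
    from piece_length_ge_halfspace[OF assms(1,2) _ step(2)[OF j] step(1)[OF j] this img, of n c]
    have piece: "L integrable_on {\<tau> j..\<tau> (Suc j)}"
      "ln (c - n \<bullet> \<gamma> (\<tau> j)) - ln (c - n \<bullet> \<gamma> (\<tau> (Suc j))) \<le> integral {\<tau> j..\<tau> (Suc j)} L"
      using assms(3) by (simp_all add: L_def)
    have int: "L integrable_on {a..\<tau> (Suc j)}"
      using IH(1) less_imp_le[OF step(1)[OF j]] IH(2) piece(1)
      by (rule Henstock_Kurzweil_Integration.integrable_combine)
    have "integral {a..\<tau> j} L + integral {\<tau> j..\<tau> (Suc j)} L = integral {a..\<tau> (Suc j)} L"
      using IH step(1)[OF j] int by (intro Henstock_Kurzweil_Integration.integral_combine) auto
    then show ?case using IH piece(2) int step(1)[OF j] by linarith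
  qed
  from this[of k] show ?thesis by (simp add: \<tau> finsler_length_def L_def)
qed

section \<open>The length of a segment and the Funk weak metric\<close>

lemma linepath_length_eq_integral:
  "finsler_length W 0 1 (linepath x y) = integral {0..1} (\<lambda>t. lagrangian W (x + t *\<^sub>R (y - x)) (y - x))"
  unfolding finsler_length_def
proof (rule integral_cong)
  fix t :: real assume "t \<in> {0..1}"
  then have "vector_derivative (linepath x y) (at t within {0..1}) = y - x"
    by (intro vector_derivative_within_cbox[of 0 1, simplified] has_vector_derivative_linepath_within) auto
  moreover have "linepath x y t = x + t *\<^sub>R (y - x)"
    by (simp add: linepath_def algebra_simps)
  ultimately show "lagrangian W (linepath x y t) (vector_derivative (linepath x y) (at t within {0..1}))
      = lagrangian W (x + t *\<^sub>R (y - x)) (y - x)" by simp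
qed

lemma linepath_length_eq_ln:
  fixes \<Omega> :: "'a::euclidean_space set"
  assumes "open \<Omega>" "convex \<Omega>" "x \<in> \<Omega>" "s > 1" "x + s *\<^sub>R (y - x) \<in> frontier \<Omega>"
  shows "finsler_length (tautological \<Omega>) 0 1 (linepath x y) = ln (s / (s - 1))"
proof -
  have L: "lagrangian (tautological \<Omega>) (x + t *\<^sub>R (y - x)) (y - x) = 1 / (s - t)" if "t \<in> {0..1}" for t
  proof (rule lagrangian_eq_inverse_exit_time[OF assms(1,2)])
    show "x + t *\<^sub>R (y - x) \<in> \<Omega>"
      using ray_mem_iff_before_exit[OF assms(1-3,5)] assms(4) that by auto
    show "x + t *\<^sub>R (y - x) + (s - t) *\<^sub>R (y - x) \<in> frontier \<Omega>"
      using assms(5) by (simp add: algebra_simps)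
  qed (use assms that in auto)
  have "((\<lambda>t. 1 / (s - t)) has_integral (- ln (s - 1)) - (- ln (s - 0))) {0..1}"
    by (rule fundamental_theorem_of_calculus)
       (use assms(4) in \<open>auto intro!: derivative_eq_intros
          simp: has_real_derivative_iff_has_vector_derivative[symmetric]\<close>)
  then have "integral {0..1} (\<lambda>t. 1 / (s - t)) = ln (s / (s - 1))"
    using assms(4) by (simp add: ln_div integral_unique)
  moreover have "integral {0..1} (\<lambda>t. lagrangian (tautological \<Omega>) (x + t *\<^sub>R (y - x)) (y - x))
      = integral {0..1} (\<lambda>t. 1 / (s - t))"
    by (rule integral_cong) (rule L)
  ultimately show ?thesis
    unfolding linepath_length_eq_integral by simp
qed

lemma funk_eq_ln:
  fixes \<Omega> :: "'a::euclidean_space set"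
  assumes "open \<Omega>" "convex \<Omega>" "x \<in> \<Omega>" "x \<noteq> y" "s > 1" "x + s *\<^sub>R (y - x) \<in> frontier \<Omega>"
  shows "funk \<Omega> x y = ln (s / (s - 1))"
proof -
  let ?a = "x + s *\<^sub>R (y - x)"
  have ray: "?a \<in> half_line x y" using assms(5) by (auto simp: half_line_def)
  have out: "?a \<notin> \<Omega>" using assms by (simp add: frontier_def interior_open)
  have unique: "z = ?a" if z: "z \<in> half_line x y \<inter> frontier \<Omega>" for z
  proof -
    obtain r where r: "r \<ge> 0" "z = x + r *\<^sub>R (y - x)" using z by (auto simp: half_line_def)
    \<comment> \<open>Neither frontier point lies in the open domain, so neither precedes the other on the ray.\<close>
    have "\<not> r < s"
      using ray_mem_iff_before_exit[OF assms(1-3,6), of r] assms(1,5) r z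
      by (auto simp: frontier_def interior_open)
    moreover have "\<not> s < r"
      using ray_mem_iff_before_exit[OF assms(1-3), of r "y - x" s] assms(5) r z out by auto
    ultimately show ?thesis using r by simp
  qed
  have "(THE a. a \<in> half_line x y \<inter> frontier \<Omega>) = ?a"
    using ray assms(6) by (intro the_equality unique) auto
  moreover have "\<not> half_line x y \<subseteq> \<Omega>" using ray out by blast
  ultimately have "funk \<Omega> x y = ln (norm (x - ?a) / norm (y - ?a))"
    using assms(4) by (simp add: funk_def Let_def)
  moreover have "norm (x - ?a) = s * norm (y - x)" using assms(5) by simp
  moreover have "y - ?a = (1 - s) *\<^sub>R (y - x)" by (simp add: algebra_simps)
  then have "norm (y - ?a) = (s - 1) * norm (y - x)" using assms(5) by simp
  ultimately show ?thesis using assms(4) by simp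
qed

theorem theorem2:
  fixes \<Omega> :: "(real ^ 'n) set"
  assumes "\<Omega> \<noteq> {}" and "open \<Omega>" and "convex \<Omega>"
    and "x \<in> \<Omega>" and "y \<in> \<Omega>"
  shows "finsler_length (tautological \<Omega>) 0 1 (linepath x y) = weak_metric \<Omega> (tautological \<Omega>) x y
       \<and> weak_metric \<Omega> (tautological \<Omega>) x y = funk \<Omega> x y"
proof -
  let ?l = "finsler_length (tautological \<Omega>) 0 1 (linepath x y)"
  have "?l = funk \<Omega> x y \<and> (\<forall>l \<in> path_lengths \<Omega> (tautological \<Omega>) x y. ?l \<le> l)"
  proof (cases "x \<noteq> y \<and> \<not> half_line x y \<subseteq> \<Omega>")
    case True
    then obtain s where s: "s \<ge> 0" and a: "x + s *\<^sub>R (y - x) \<in> frontier \<Omega>"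
      using ray_exits_at_frontier[OF assms(4)] by blast
    have s1: "s > 1"
      using ray_mem_iff_before_exit[OF assms(2-4) a s, of 1] assms(5) by simp
    have len: "?l = ln (s / (s - 1))" by (rule linepath_length_eq_ln[OF assms(2-4) s1 a])
    have "x + s *\<^sub>R (y - x) \<notin> \<Omega>" using a assms(2) by (simp add: frontier_def interior_open)
    then obtain n where n: "\<And>z. z \<in> \<Omega> \<Longrightarrow> n \<bullet> z < n \<bullet> (x + s *\<^sub>R (y - x))"
      using supporting_hyperplane_open_convex[OF assms(2,3)] by blast
    let ?c = "n \<bullet> (x + s *\<^sub>R (y - x))"
    have cx: "?c - n \<bullet> x = s * (n \<bullet> (y - x))" and cy: "?c - n \<bullet> y = (s - 1) * (n \<bullet> (y - x))"
      by (simp_all add: algebra_simps inner_diff_right inner_add_right)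
    have pos: "n \<bullet> (y - x) > 0"
      using n[OF assms(4)] cx s1 by (simp add: inner_add_right zero_less_mult_iff)
    have "ln (?c - n \<bullet> x) - ln (?c - n \<bullet> y) = ?l"
      unfolding cx cy len using s1 pos by (simp add: ln_mult ln_div)
    then have "?l \<le> l" if "l \<in> path_lengths \<Omega> (tautological \<Omega>) x y" for l
      using that path_length_ge_halfspace[OF assms(2,3) n] unfolding path_lengths_def by fastforce
    then show ?thesis using len funk_eq_ln[OF assms(2-4) _ s1 a] True by auto
  next
    case False
    have ray: "x + r *\<^sub>R (y - x) \<in> \<Omega>" if "r \<ge> 0" for r
      using False that assms(4) by (auto simp: half_line_def)
    have zero: "lagrangian (tautological \<Omega>) (x + t *\<^sub>R (y - x)) (y - x) = 0" if "t \<in> {0..1}" for t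
    proof (rule lagrangian_eq_0_of_ray_subset)
      show "x + t *\<^sub>R (y - x) + r *\<^sub>R (y - x) \<in> \<Omega>" if "r \<ge> 0" for r
        using ray[of "t + r"] that \<open>t \<in> {0..1}\<close> by (simp add: algebra_simps)
    qed (use ray that in auto)
    have "?l = integral {0..1::real} (\<lambda>_. 0)"
      unfolding linepath_length_eq_integral by (rule integral_cong[OF zero])
    then have "?l = 0" by simp
    moreover have "funk \<Omega> x y = 0" using False by (auto simp: funk_def)
    ultimately show ?thesis using path_lengths_nonneg[OF assms(2)] by auto
  qed
  moreover have "?l \<in> path_lengths \<Omega> (tautological \<Omega>) x y"
    by (rule linepath_length_in_path_lengths[OF assms(3-5)])
  ultimately show ?thesis
    unfolding weak_metric_def by (metis cInf_eq_minimum)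
qed

end
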